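(* Let $(L,A,\mathfrak m,\ell)$ be a left-symmetric Rinehart algebra over a field $\mathbb K$ of characteristic zero, let $n\ge1$, and let $\mathfrak m_t=\sum_{i=0}^n t^i\mathfrak m_i$ be a deformation of $\mathfrak m$ of order $n$. Then $\mathfrak m_t$ extends to a deformation of order $n+1$ if and only if the cohomology class of the obstruction cochain $Obs_L$ vanishes, i.e. $Obs_L=\delta(\mathfrak m_{n+1})$ for some $\mathfrak m_{n+1}\in\mathfrak D^1(L)$.
   Context: All vector spaces are over a field $\mathbb K$ of characteristic zero. A left-symmetric Rinehart algebra is a quadruple $(L,A,\mathfrak m,\ell)$ where $A$ is an associative commutative $\mathbb K$-algebra, $L$ is an $A$-module with a bilinear product $\mathfrak m(x,y)=x\cdot y$ satisfying $(x\cdot y)\cdot z-x\cdot(y\cdot z)=(y\cdot x)\cdot z-y\cdot(x\cdot z)$, and $\ell:L\to \mathrm{Der}(A)$ is a linear map such that $\ell(x\cdot y-y\cdot x)=\ell(x)\ell(y)-\ell(y)\ell(x)$, $\ell(ax)=a\ell(x)$, $x\cdot(ay)=\ell(x)(a)\,y+a(x\cdot y)$, and $(ax)\cdot y=a(x\cdot y)$ for all $a\in A$, $x,y,z\in L$. Write $[x,y]=x\cdot y-y\cdot x$. $\mathfrak D^1(L)$ is the space of $\mathbb K$-bilinear maps $P:L\otimes L\to L$ with $P(ax,y)=aP(x,y)$ and $P(x,ay)=aP(x,y)+\Xi_P(x)(a)y$ for a linear map $\Xi_P:L\to\mathrm{Der}(A)$ (the symbol). For $P\in\mathfrak D^1(L)$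 the coboundary is $$\delta P(x,y,z)=x\cdot P(y,z)-y\cdot P(x,z)+P(y,x)\cdot z-P(x,y)\cdot z-P(y,x\cdot z)+P(x,y\cdot z)-P([x,y],z).$$ A deformation of order $n$ is $\mathfrak m_t=\sum_{i=0}^nt^i\mathfrak m_i$ with $\mathfrak m_0=\mathfrak m$, $\mathfrak m_i\in\mathfrak D^1(L)$ with symbols $\ell_i:L\to\mathrm{Der}(A)$ (and $\ell_0=\ell$), such that for each $0\le k\le n$ and all $x,y,z\in L$ $$\sum_{i+j=k}\big(\mathfrak m_i(\mathfrak m_j(x,y),z)-\mathfrak m_i(x,\mathfrak m_j(y,z))-\mathfrak m_i(\mathfrak m_j(y,x),z)+\mathfrak m_i(y,\mathfrak m_j(x,z))\big)=0.$$ It extends to a deformation of order $n+1$ if there is $\mathfrak m_{n+1}\in\mathfrak D^1(L)$ (with symbol $\ell_{n+1}:L\to \mathrm{Der}(A)$) such that $\mathfrak m_t+t^{n+1}\mathfrak m_{n+1}$ is a deformation of order $n+1$. The obstruction cochain is $$Obs_L(x,y,z)=\sum_{i+j=n+1,\ i,j>0}\big(\mathfrak m_i(\mathfrak m_j(x,y),z)-\mathfrak m_i(x,\mathfrak m_j(y,z))-\mathfrak m_i(\mathfrak m_j(y,x),z)+\mathfrak m_i(y,\mathfrak m_j(x,z))\big).$$ *)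

theory Defs
  imports Complex_Main
begin

text \<open>
  The base field acts on \<open>A\<close> by \<open>scaleA\<close> and on \<open>L\<close> by \<open>scaleL\<close>, and \<open>A\<close> acts on \<open>L\<close> by \<open>act\<close>.
  Neither \<open>A\<close> nor its action is assumed unital; unital algebras (the zero algebra included) with
  unitary modules are a special case. This is why the library locale \<open>module\<close>, which needs
  \<open>comm_ring_1\<close>, is not used for \<open>act\<close>.
\<close>

locale comm_assoc_algebra = vector_space scaleA
  for scaleA :: "'k::field_char_0 \<Rightarrow> 'a::comm_ring \<Rightarrow> 'a" +
  assumes scale_mult: "scaleA c (a * b) = scaleA c a * b"

locale algebra_module = A: comm_assoc_algebra scaleA + L: vector_space scaleL
  for scaleA :: "'k::field_char_0 \<Rightarrow> 'a::comm_ring \<Rightarrow> 'a"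
    and scaleL :: "'k \<Rightarrow> 'l::ab_group_add \<Rightarrow> 'l" +
  fixes act :: "'a \<Rightarrow> 'l \<Rightarrow> 'l"
  assumes act_add_left: "act (a + b) x = act a x + act b x"
    and act_add_right: "act a (x + y) = act a x + act a y"
    and act_mult: "act (a * b) x = act a (act b x)"
    and act_scale_left: "act (scaleA c a) x = scaleL c (act a x)"
    and act_scale_right: "act a (scaleL c x) = scaleL c (act a x)"

definition Der :: "('k::field_char_0 \<Rightarrow> 'a::comm_ring \<Rightarrow> 'a) \<Rightarrow> ('a \<Rightarrow> 'a) set" where
  "Der scaleA = {D. Vector_Spaces.linear scaleA scaleA D \<and>
                    (\<forall>a b. D (a * b) = D a * b + a * D b)}"

text \<open>Linear maps \<open>L \<rightarrow> Der(A)\<close>; the linear structure on \<open>Der(A)\<close> is pointwise.\<close>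

definition linear_to_Der ::
  "('k::field_char_0 \<Rightarrow> 'a::comm_ring \<Rightarrow> 'a) \<Rightarrow> ('k \<Rightarrow> 'l::ab_group_add \<Rightarrow> 'l) \<Rightarrow>
   ('l \<Rightarrow> 'a \<Rightarrow> 'a) \<Rightarrow> bool" where
  "linear_to_Der scaleA scaleL \<Xi> \<longleftrightarrow>
     (\<forall>x. \<Xi> x \<in> Der scaleA) \<and> (\<forall>a. Vector_Spaces.linear scaleL scaleA (\<lambda>x. \<Xi> x a))"

definition bilinear_map ::
  "('k::field_char_0 \<Rightarrow> 'l::ab_group_add \<Rightarrow> 'l) \<Rightarrow> ('l \<Rightarrow> 'l \<Rightarrow> 'l) \<Rightarrow> bool" where
  "bilinear_map scaleL P \<longleftrightarrow>
     (\<forall>x. Vector_Spaces.linear scaleL scaleL (\<lambda>y. P x y)) \<and>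
     (\<forall>y. Vector_Spaces.linear scaleL scaleL (\<lambda>x. P x y))"

locale left_symmetric_Rinehart_algebra = algebra_module scaleA scaleL act
  for scaleA :: "'k::field_char_0 \<Rightarrow> 'a::comm_ring \<Rightarrow> 'a"
    and scaleL :: "'k \<Rightarrow> 'l::ab_group_add \<Rightarrow> 'l"
    and act :: "'a \<Rightarrow> 'l \<Rightarrow> 'l" +
  fixes m :: "'l \<Rightarrow> 'l \<Rightarrow> 'l" and \<l> :: "'l \<Rightarrow> 'a \<Rightarrow> 'a"
  assumes bilinear_m: "bilinear_map scaleL m"
    and left_symmetric: "m (m x y) z - m x (m y z) = m (m y x) z - m y (m x z)"
    and linear_anchor: "linear_to_Der scaleA scaleL \<l>"
    and anchor_commutator: "\<l> (m x y - m y x) a = \<l> x (\<l> y a) - \<l> y (\<l> x a)"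
    and anchor_act: "\<l> (act a x) b = a * \<l> x b"
    and m_act_right: "m x (act a y) = act (\<l> x a) y + act a (m x y)"
    and m_act_left: "m (act a x) y = act a (m x y)"

text \<open>The symbol of \<open>P\<close> need not be unique if \<open>A\<close> does not act faithfully on \<open>L\<close>, so it is a
  relation between \<open>P\<close> and \<open>\<Xi>\<close>.\<close>

definition has_symbol ::
  "('k::field_char_0 \<Rightarrow> 'a::comm_ring \<Rightarrow> 'a) \<Rightarrow> ('k \<Rightarrow> 'l::ab_group_add \<Rightarrow> 'l) \<Rightarrow>
   ('a \<Rightarrow> 'l \<Rightarrow> 'l) \<Rightarrow> ('l \<Rightarrow> 'l \<Rightarrow> 'l) \<Rightarrow> ('l \<Rightarrow> 'a \<Rightarrow> 'a) \<Rightarrow> bool" where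
  "has_symbol scaleA scaleL act P \<Xi> \<longleftrightarrow>
     linear_to_Der scaleA scaleL \<Xi> \<and>
     (\<forall>x a y. P x (act a y) = act a (P x y) + act (\<Xi> x a) y)"

definition D1 ::
  "('k::field_char_0 \<Rightarrow> 'a::comm_ring \<Rightarrow> 'a) \<Rightarrow> ('k \<Rightarrow> 'l::ab_group_add \<Rightarrow> 'l) \<Rightarrow>
   ('a \<Rightarrow> 'l \<Rightarrow> 'l) \<Rightarrow> ('l \<Rightarrow> 'l \<Rightarrow> 'l) set" where
  "D1 scaleA scaleL act =
     {P. bilinear_map scaleL P \<and> (\<forall>a x y. P (act a x) y = act a (P x y)) \<and>
         (\<exists>\<Xi>. has_symbol scaleA scaleL act P \<Xi>)}"

definition coboundary ::
  "('l::ab_group_add \<Rightarrow> 'l \<Rightarrow> 'l) \<Rightarrow> ('l \<Rightarrow> 'l \<Rightarrow> 'l) \<Rightarrow> 'l \<Rightarrow> 'l \<Rightarrow> 'l \<Rightarrow> 'l" where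
  "coboundary m P x y z =
     m x (P y z) - m y (P x z) + m (P y x) z - m (P x y) z
     - P y (m x z) + P x (m y z) - P (m x y - m y x) z"

definition lsym_term ::
  "('l::ab_group_add \<Rightarrow> 'l \<Rightarrow> 'l) \<Rightarrow> ('l \<Rightarrow> 'l \<Rightarrow> 'l) \<Rightarrow> 'l \<Rightarrow> 'l \<Rightarrow> 'l \<Rightarrow> 'l" where
  "lsym_term P Q x y z = P (Q x y) z - P x (Q y z) - P (Q y x) z + P y (Q x z)"

text \<open>A deformation \<open>\<Sum>i\<le>n. t^i \<mu>\<^sub>i\<close> of order \<open>n\<close> is given by its coefficients
  \<open>\<mu> 0, \<dots>, \<mu> n\<close>; the values of \<open>\<mu>\<close> beyond \<open>n\<close> are irrelevant.\<close>

definition deformation ::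
  "('k::field_char_0 \<Rightarrow> 'a::comm_ring \<Rightarrow> 'a) \<Rightarrow> ('k \<Rightarrow> 'l::ab_group_add \<Rightarrow> 'l) \<Rightarrow>
   ('a \<Rightarrow> 'l \<Rightarrow> 'l) \<Rightarrow> ('l \<Rightarrow> 'l \<Rightarrow> 'l) \<Rightarrow> ('l \<Rightarrow> 'a \<Rightarrow> 'a) \<Rightarrow>
   nat \<Rightarrow> (nat \<Rightarrow> 'l \<Rightarrow> 'l \<Rightarrow> 'l) \<Rightarrow> bool" where
  "deformation scaleA scaleL act m \<l> n \<mu> \<longleftrightarrow>
     \<mu> 0 = m \<and>
     (\<forall>i\<le>n. \<mu> i \<in> D1 scaleA scaleL act) \<and>
     (\<exists>ls. ls 0 = \<l> \<and> (\<forall>i\<le>n. has_symbol scaleA scaleL act (\<mu> i) (ls i))) \<and>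
     (\<forall>k\<le>n. \<forall>x y z. (\<Sum>(i, j)\<in>{(i, j). i + j = k}. lsym_term (\<mu> i) (\<mu> j) x y z) = 0)"

definition extends ::
  "('k::field_char_0 \<Rightarrow> 'a::comm_ring \<Rightarrow> 'a) \<Rightarrow> ('k \<Rightarrow> 'l::ab_group_add \<Rightarrow> 'l) \<Rightarrow>
   ('a \<Rightarrow> 'l \<Rightarrow> 'l) \<Rightarrow> ('l \<Rightarrow> 'l \<Rightarrow> 'l) \<Rightarrow> ('l \<Rightarrow> 'a \<Rightarrow> 'a) \<Rightarrow>
   nat \<Rightarrow> (nat \<Rightarrow> 'l \<Rightarrow> 'l \<Rightarrow> 'l) \<Rightarrow> bool" where
  "extends scaleA scaleL act m \<l> n \<mu> \<longleftrightarrow>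
     (\<exists>P \<in> D1 scaleA scaleL act. deformation scaleA scaleL act m \<l> (n + 1) (\<mu>(n + 1 := P)))"

definition Obs ::
  "nat \<Rightarrow> (nat \<Rightarrow> 'l::ab_group_add \<Rightarrow> 'l \<Rightarrow> 'l) \<Rightarrow> 'l \<Rightarrow> 'l \<Rightarrow> 'l \<Rightarrow> 'l" where
  "Obs n \<mu> x y z =
     (\<Sum>(i, j)\<in>{(i, j). i + j = n + 1 \<and> 0 < i \<and> 0 < j}. lsym_term (\<mu> i) (\<mu> j) x y z)"

end

(* In the equation of order n + 1 only the terms (0, n + 1) and (n + 1, 0) involve the new
   coefficient P; together they are -\<delta>P, and the remaining terms are Obs. The equations of
   lower order do not involve P. *)

theory Submission imports Defs begin

lemma bilinear_map_diff_left:
  assumes "bilinear_map scaleL P"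
  shows "P (x - y) z = P x z - P y z"
proof -
  interpret Vector_Spaces.linear scaleL scaleL "\<lambda>x. P x z"
    using assms by (simp add: bilinear_map_def)
  show ?thesis by (rule diff)
qed

text \<open>Additivity of \<open>P\<close> in its first argument splits the commutator term
  \<open>P (m x y - m y x) z\<close> of \<delta>P in two; the eight resulting terms then match with
  opposite signs.\<close>

lemma lsym_term_add_eq_coboundary:
  assumes "bilinear_map scaleL P"
  shows "lsym_term m P x y z + lsym_term P m x y z = - coboundary m P x y z"
  by (simp add: lsym_term_def coboundary_def bilinear_map_diff_left[OF assms])

lemma sum_lsym_term_upd:
  assumes "bilinear_map scaleL P" "\<mu> 0 = m"
  shows "(\<Sum>(i, j)\<in>{(i, j). i + j = n + 1}.
           lsym_term ((\<mu>(n + 1 := P)) i) ((\<mu>(n + 1 := P)) j) x y z) =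
         Obs n \<mu> x y z - coboundary m P x y z"
proof -
  let ?I = "{(i, j). i + j = n + 1 \<and> 0 < i \<and> 0 < j}"
  let ?f = "\<lambda>(i, j). lsym_term ((\<mu>(n + 1 := P)) i) ((\<mu>(n + 1 := P)) j) x y z"
  \<comment> \<open>The pairs with a zero index are split off. Since \<open>n + 1\<close> is nonzero
    they are distinct and lie outside \<open>?I\<close>, so with \<open>?I\<close> finite each
    contributes its own summand.\<close>
  have split: "{(i, j). i + j = n + 1} = insert (0, n + 1) (insert (n + 1, 0) ?I)"
    by auto
  have "finite ?I"
    by (rule finite_subset[of _ "{..n + 1} \<times> {..n + 1}"]) auto
  then have "sum ?f {(i, j). i + j = n + 1} =
      lsym_term m P x y z + (lsym_term P m x y z + sum ?f ?I)"
    unfolding split using assms(2) by simp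
  \<comment> \<open>Both indices are positive with sum \<open>n + 1\<close>, hence at most
    \<open>n\<close>, where the update at \<open>n + 1\<close> is invisible.\<close>
  moreover have "sum ?f ?I = Obs n \<mu> x y z"
    unfolding Obs_def by (rule sum.cong) auto
  ultimately show ?thesis
    using lsym_term_add_eq_coboundary[OF assms(1), of m x y z] by (simp add: algebra_simps)
qed

text \<open>If \<open>i + j = k\<close>, neither index exceeds \<open>k\<close>. This carries the
  equations of order at most \<open>n\<close> over to the updated family.\<close>

lemma sum_lsym_term_cong:
  fixes k :: nat
  assumes "\<And>i. i \<le> k \<Longrightarrow> \<mu> i = \<nu> i"
  shows "(\<Sum>(i, j)\<in>{(i, j). i + j = k}. lsym_term (\<mu> i) (\<mu> j) x y z) =
         (\<Sum>(i, j)\<in>{(i, j). i + j = k}. lsym_term (\<nu> i) (\<nu> j) x y z)"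
  by (rule sum.cong) (auto simp: assms)

text \<open>With \<open>P\<close> fixed, every condition on the updated family except the equation
  of order \<open>n + 1\<close> is inherited from \<mu> or from membership of \<open>P\<close> in
  \<open>D1\<close>.\<close>

lemma deformation_upd_iff:
  assumes "deformation scaleA scaleL act m \<l> n \<mu>" "P \<in> D1 scaleA scaleL act"
  shows "deformation scaleA scaleL act m \<l> (n + 1) (\<mu>(n + 1 := P)) \<longleftrightarrow>
    Obs n \<mu> = coboundary m P"
proof -
  let ?\<nu> = "\<mu>(n + 1 := P)"
  have m: "\<mu> 0 = m" and D1: "\<And>i. i \<le> n \<Longrightarrow> \<mu> i \<in> D1 scaleA scaleL act"
    and eqs: "\<And>k x y z. k \<le> n \<Longrightarrow>
      (\<Sum>(i, j)\<in>{(i, j). i + j = k}. lsym_term (\<mu> i) (\<mu> j) x y z) = 0"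
    using assms(1) by (auto simp: deformation_def)
  obtain ls where ls: "ls 0 = \<l>" "\<And>i. i \<le> n \<Longrightarrow> has_symbol scaleA scaleL act (\<mu> i) (ls i)"
    using assms(1) by (auto simp: deformation_def)
  obtain \<Xi> where \<Xi>: "has_symbol scaleA scaleL act P \<Xi>" and P: "bilinear_map scaleL P"
    using assms(2) by (auto simp: D1_def)
  \<comment> \<open>Any symbol of \<open>P\<close> may be put at place \<open>n + 1\<close>; place 0
    still holds the anchor because \<open>n + 1\<close> is nonzero.\<close>
  have "(ls(n + 1 := \<Xi>)) 0 = \<l> \<and>
      (\<forall>i\<le>n + 1. has_symbol scaleA scaleL act (?\<nu> i) ((ls(n + 1 := \<Xi>)) i))"
    using ls \<Xi> by (auto simp: le_Suc_eq)
  then have symbols: "\<exists>ls. ls 0 = \<l> \<and> (\<forall>i\<le>n + 1. has_symbol scaleA scaleL act (?\<nu> i) (ls i))"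
    by blast
  have lower: "(\<Sum>(i, j)\<in>{(i, j). i + j = k}. lsym_term (?\<nu> i) (?\<nu> j) x y z) = 0"
    if "k \<le> n" for k x y z
    using sum_lsym_term_cong[of k ?\<nu> \<mu> x y z] eqs[OF that] that by simp
  have "(\<forall>k\<le>n + 1. \<forall>x y z.
      (\<Sum>(i, j)\<in>{(i, j). i + j = k}. lsym_term (?\<nu> i) (?\<nu> j) x y z) = 0) \<longleftrightarrow>
    (\<forall>x y z. (\<Sum>(i, j)\<in>{(i, j). i + j = n + 1}. lsym_term (?\<nu> i) (?\<nu> j) x y z) = 0)"
    (is "(\<forall>k\<le>n + 1. ?Q k) \<longleftrightarrow> ?Q (n + 1)")
  proof -
    have "?Q k" if "k \<le> n" for k
      using lower[OF that] by blast
    moreover have "k \<le> n + 1 \<longleftrightarrow> k \<le> n \<or> k = n + 1" for k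
      by linarith
    ultimately show ?thesis
      by blast
  qed
  \<comment> \<open>At each \<open>x y z\<close> the sum is Obs minus \<delta>P, so its vanishing
    everywhere is an equality of cochains.\<close>
  also have "\<dots> \<longleftrightarrow> Obs n \<mu> = coboundary m P"
    unfolding sum_lsym_term_upd[of scaleL P \<mu> m, OF P m] by (auto simp: fun_eq_iff)
  finally have eqs_iff: "(\<forall>k\<le>n + 1. \<forall>x y z.
      (\<Sum>(i, j)\<in>{(i, j). i + j = k}. lsym_term (?\<nu> i) (?\<nu> j) x y z) = 0) \<longleftrightarrow>
    Obs n \<mu> = coboundary m P" .
  have "?\<nu> 0 = m" "\<forall>i\<le>n + 1. ?\<nu> i \<in> D1 scaleA scaleL act"
    using m D1 assms(2) by (auto simp: le_Suc_eq)
  then show ?thesis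
    using symbols unfolding deformation_def eqs_iff by blast
qed

theorem theorem6p11:
  fixes scaleA :: "'k::field_char_0 \<Rightarrow> 'a::comm_ring \<Rightarrow> 'a"
    and scaleL :: "'k \<Rightarrow> 'l::ab_group_add \<Rightarrow> 'l"
    and act :: "'a \<Rightarrow> 'l \<Rightarrow> 'l"
    and m :: "'l \<Rightarrow> 'l \<Rightarrow> 'l"
    and \<l> :: "'l \<Rightarrow> 'a \<Rightarrow> 'a"
    and \<mu> :: "nat \<Rightarrow> 'l \<Rightarrow> 'l \<Rightarrow> 'l"
    and n :: nat
  assumes "left_symmetric_Rinehart_algebra scaleA scaleL act m \<l>"
    and "n \<ge> 1"
    and "deformation scaleA scaleL act m \<l> n \<mu>"
  shows "extends scaleA scaleL act m \<l> n \<mu> \<longleftrightarrow>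
    (\<exists>P \<in> D1 scaleA scaleL act. Obs n \<mu> = coboundary m P)"
  \<comment> \<open>Both sides quantify over the same \<open>P\<close> in \<open>D1\<close>, so the
    equivalence for fixed \<open>P\<close> suffices.\<close>
  unfolding extends_def using deformation_upd_iff[OF assms(3)] by blast

end
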